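(* Let $A\in\mathbb{R}^{n_x\times n_x}$, $B\in\mathbb{R}^{n_x\times n_u}$ with $(A,B)$ stabilizable and $\rho(A)>0$; let $Q=Q^T>0$ and $R=R^T>0$; let $\tilde\beta>0$, $\alpha_0>0$ with $\tilde\beta+\alpha_0<1/\rho(A)$; and let $\tilde K^0=0$. For $j=0,1,2,\ldots$ write $\gamma_j=\tilde\beta+\sum_{m=0}^{j}\alpha_m$, and consider the iteration in which $\tilde P^j=(\tilde P^j)^T$ solves the step-$j$ Lyapunov equation $$[\gamma_j(A-B\tilde K^j)]^T\tilde P^j[\gamma_j(A-B\tilde K^j)]-\tilde P^j=-Q-(\tilde K^j)^TR\tilde K^j,$$ the gain is updated by $$\tilde K^{j+1}=\gamma_j^2\big[R+\gamma_j^2B^T\tilde P^jB\big]^{-1}B^T\tilde P^jA,$$ and $\alpha_{j+1}$ is any number satisfying $$0<\alpha_{j+1}<\gamma_j\sqrt{\frac{\sigma_{\min}[Q+(\tilde K^{j+1})^TR\tilde K^{j+1}]}{\sigma_{\max}[\tilde P^j-Q-(\tilde K^{j+1})^TR\tilde K^{j+1}]}+1}\;-\;\gamma_j .$$ Then for every $j\ge 0$ there exists a unique positive definite solution $\tilde P^{j+1}$ to the step-$(j+1)$ Lyapunov equation $$[\gamma_{j+1}(A-B\tilde K^{j+1})]^T\tilde P^{j+1}[\gamma_{j+1}(A-B\tilde K^{j+1})]-\tilde P^{j+1}=-Q-(\tilde K^{j+1})^TR\tilde K^{j+1},$$ and $\tilde K^{j+1}$ is a stabilizing control gain of the closed-loop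 artificial system with matrix $\gamma_{j+1}(A-B\tilde K^{j+1})$, i.e. $\rho[\gamma_{j+1}(A-B\tilde K^{j+1})]<1$.
   Context: $\rho(\cdot)$ is the spectral radius; $\sigma_{\max}(\cdot)$ and $\sigma_{\min}(\cdot)$ are the maximum and minimum singular values. For symmetric matrices, $>0$ means positive definite. *)

theory Defs
  imports "Jordan_Normal_Form.Spectral_Radius"
    "Jordan_Normal_Form.Gauss_Jordan_Elimination"
begin

definition real_spectral_radius :: "real mat \<Rightarrow> real" where
  "real_spectral_radius A = spectral_radius (map_mat complex_of_real A)"

(* The square roots of the eigenvalues of the Gram matrix.  It is symmetric and positive
   semidefinite, so its real eigenvalues are all of its eigenvalues.  For a matrix with more
   columns than rows this would list additional zeros; it is used for square matrices only. *)
definition singular_values :: "real mat \<Rightarrow> real set" where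
  "singular_values A = sqrt ` spectrum (A\<^sup>T * A)"

definition sigma_max :: "real mat \<Rightarrow> real" where
  "sigma_max A = Max (singular_values A)"

definition sigma_min :: "real mat \<Rightarrow> real" where
  "sigma_min A = Min (singular_values A)"

definition symmetric_matrix :: "nat \<Rightarrow> real mat \<Rightarrow> bool" where
  "symmetric_matrix n P \<longleftrightarrow> P \<in> carrier_mat n n \<and> P\<^sup>T = P"

definition pos_definite :: "nat \<Rightarrow> real mat \<Rightarrow> bool" where
  "pos_definite n P \<longleftrightarrow> symmetric_matrix n P \<and>
     (\<forall>x \<in> carrier_vec n. x \<noteq> 0\<^sub>v n \<longrightarrow> x \<bullet> (P *\<^sub>v x) > 0)"

definition stabilizable :: "nat \<Rightarrow> nat \<Rightarrow> real mat \<Rightarrow> real mat \<Rightarrow> bool" where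
  "stabilizable n m A B \<longleftrightarrow>
     (\<exists>K \<in> carrier_mat m n. real_spectral_radius (A - B * K) < 1)"

definition closed_loop :: "real \<Rightarrow> real mat \<Rightarrow> real mat \<Rightarrow> real mat \<Rightarrow> real mat" where
  "closed_loop g A B K = g \<cdot>\<^sub>m (A - B * K)"

definition lyapunov_equation ::
  "real \<Rightarrow> real mat \<Rightarrow> real mat \<Rightarrow> real mat \<Rightarrow> real mat \<Rightarrow> real mat \<Rightarrow> real mat \<Rightarrow> bool" where
  "lyapunov_equation g A B Q R K P \<longleftrightarrow>
     (closed_loop g A B K)\<^sup>T * P * closed_loop g A B K - P = - Q - K\<^sup>T * R * K"

(* mat_inverse returns an option; the matrix inverted here is R plus a positive semidefinite
   matrix whenever P is positive semidefinite, so the inverse exists along the iteration. *)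
definition gain_update ::
  "real \<Rightarrow> real mat \<Rightarrow> real mat \<Rightarrow> real mat \<Rightarrow> real mat \<Rightarrow> real mat" where
  "gain_update g A B R P =
     g\<^sup>2 \<cdot>\<^sub>m (the (mat_inverse (R + g\<^sup>2 \<cdot>\<^sub>m (B\<^sup>T * P * B))) * B\<^sup>T * P * A)"

(* Upper bound for the next increment; K is the updated gain. *)
definition step_bound ::
  "real \<Rightarrow> real mat \<Rightarrow> real mat \<Rightarrow> real mat \<Rightarrow> real mat \<Rightarrow> real" where
  "step_bound g Q R P K =
     g * sqrt (sigma_min (Q + K\<^sup>T * R * K) / sigma_max (P - Q - K\<^sup>T * R * K) + 1) - g"

end

theory Submission
  imports Defs
begin

text \<open>Completing the square in the Lyapunov equation shows that along the new closed loop the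
  quadratic form of $P_j$ satisfies $\gamma_j^2 V(Fx) \le V(x) - x^T S x$, where $F = A - B K_{j+1}$ and
  $S = Q + K_{j+1}^T R K_{j+1}$. Rescaling by $r = \gamma_{j+1} / \gamma_j$ costs at most
  $(r^2 - 1) \sigma_{\max}(P_j - S) |x|^2$, and the bound on the increment says exactly that this is
  smaller than $\sigma_{\min}(S) |x|^2$. Hence $V$ is a strict Lyapunov function of the rescaled
  loop, which yields stability and, through the convergent series $\sum_k (F^k)^T S F^k$, the next
  solution. Stability in turn makes that solution positive definite, which closes the induction.\<close>

subsection \<open>Bilinear forms of real matrices\<close>

text \<open>Matrices are handled through the numbers x^T M y: these determine M, and congruences and
  completed squares become ring calculations over the reals. The obstacle is that both the
  hypotheses and the goal are spectral, while the argument is about real quadratic forms. The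
  spectral radius is linked to forms in both directions: strict decrease of a definite form confines
  the complex eigenvalues to the open unit disc, and a radius below 1 sends every trajectory to 0.
  Singular values enter through an extremal eigenvalue of a symmetric matrix, obtained from a
  supremum without diagonalisation. The two singular values in the increment bound behave
  differently: \<open>sigma_max\<close> dominates the form of any symmetric matrix, so the signs of
  the eigenvalues of P_j - S do not matter, whereas \<open>sigma_min\<close> bounds a form from
  below only thanks to the definiteness of S. Since the P_j are merely assumed symmetric, the
  induction carries stability of the loop and recovers definiteness from it. It starts from the zero
  gain, whose loop is gamma_0 A; this is where beta + alpha_0 < 1/rho(A) enters.\<close>

definition bil :: "real mat \<Rightarrow> real vec \<Rightarrow> real vec \<Rightarrow> real" where
  "bil M x y = x \<bullet> (M *\<^sub>v y)"

lemma bil_sum: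
  assumes "M \<in> carrier_mat n m" "x \<in> carrier_vec n" "y \<in> carrier_vec m"
  shows "bil M x y = (\<Sum>i<n. \<Sum>j<m. x $ i * M $$ (i,j) * y $ j)"
  using assms by (auto simp: bil_def scalar_prod_def sum_distrib_left mult.assoc atLeast0LessThan
      intro!: sum.cong)

lemma bil_unit_vec:
  assumes "M \<in> carrier_mat n m" "i < n" "j < m"
  shows "bil M (unit_vec n i) (unit_vec m j) = M $$ (i,j)"
  using assms by (simp add: bil_def)

text \<open>Unit vectors pick out the entries. Symmetry, the Lyapunov equation and uniqueness of its
  solution are all reduced to scalars this way.\<close>

lemma mat_eqI_bil:
  assumes "M \<in> carrier_mat n m" "N \<in> carrier_mat n m"
    and "\<And>x y. x \<in> carrier_vec n \<Longrightarrow> y \<in> carrier_vec m \<Longrightarrow> bil M x y = bil N x y"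
  shows "M = N"
proof (rule eq_matI)
  fix i j assume "i < dim_row N" "j < dim_col N"
  then have "i < n" "j < m" using assms by auto
  then show "M $$ (i,j) = N $$ (i,j)"
    using assms(3)[of "unit_vec n i" "unit_vec m j"] bil_unit_vec assms(1,2) by simp
qed (use assms in auto)

context
  fixes M :: "real mat" and n m :: nat
  assumes M: "M \<in> carrier_mat n m"
begin

lemma bil_add_left:
  assumes "x \<in> carrier_vec n" "x' \<in> carrier_vec n" "y \<in> carrier_vec m"
  shows "bil M (x + x') y = bil M x y + bil M x' y"
  using assms M by (simp add: bil_def add_scalar_prod_distrib[of _ n])

lemma bil_add_right:
  assumes "x \<in> carrier_vec n" "y \<in> carrier_vec m" "y' \<in> carrier_vec m"
  shows "bil M x (y + y') = bil M x y + bil M x y'"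
  using assms M by (simp add: bil_def mult_add_distrib_mat_vec[of _ n m] scalar_prod_add_distrib[of _ n])

lemma bil_diff_left:
  assumes "x \<in> carrier_vec n" "x' \<in> carrier_vec n" "y \<in> carrier_vec m"
  shows "bil M (x - x') y = bil M x y - bil M x' y"
  using assms M by (simp add: bil_def minus_scalar_prod_distrib[of _ n])

lemma bil_diff_right:
  assumes "x \<in> carrier_vec n" "y \<in> carrier_vec m" "y' \<in> carrier_vec m"
  shows "bil M x (y - y') = bil M x y - bil M x y'"
  using assms M by (simp add: bil_def mult_minus_distrib_mat_vec[of _ n m] scalar_prod_minus_distrib[of _ n])

lemma bil_smult_left:
  assumes "x \<in> carrier_vec n" "y \<in> carrier_vec m"
  shows "bil M (c \<cdot>\<^sub>v x) y = c * bil M x y"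
  using assms M by (simp add: bil_def)

lemma bil_smult_right:
  assumes "x \<in> carrier_vec n" "y \<in> carrier_vec m"
  shows "bil M x (c \<cdot>\<^sub>v y) = c * bil M x y"
  using assms M by (simp add: bil_def mult_mat_vec[of _ n m])

lemma bil_add_mat:
  assumes "N \<in> carrier_mat n m" "x \<in> carrier_vec n" "y \<in> carrier_vec m"
  shows "bil (M + N) x y = bil M x y + bil N x y"
  using assms M by (simp add: bil_def add_mult_distrib_mat_vec[of _ n m] scalar_prod_add_distrib[of _ n])

lemma bil_diff_mat:
  assumes "N \<in> carrier_mat n m" "x \<in> carrier_vec n" "y \<in> carrier_vec m"
  shows "bil (M - N) x y = bil M x y - bil N x y"
  using assms M by (simp add: bil_def minus_mult_distrib_mat_vec[of _ n m] scalar_prod_minus_distrib[of _ n])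

lemma bil_uminus_mat:
  assumes "x \<in> carrier_vec n" "y \<in> carrier_vec m"
  shows "bil (- M) x y = - bil M x y"
  using assms M by (simp add: bil_def)

lemma bil_smult_mat:
  assumes "x \<in> carrier_vec n" "y \<in> carrier_vec m"
  shows "bil (c \<cdot>\<^sub>m M) x y = c * bil M x y"
  using assms M by (simp add: bil_sum[of _ n m] sum_distrib_left mult_ac)

lemma bil_transpose:
  assumes "x \<in> carrier_vec n" "y \<in> carrier_vec m"
  shows "bil (M\<^sup>T) y x = bil M x y"
  using assms M transpose_vec_mult_scalar[OF M assms(2,1)] 
  by (simp add: bil_def comm_scalar_prod[of y m])

lemma bil_mult_right:
  assumes "F \<in> carrier_mat m p" "x \<in> carrier_vec n" "y \<in> carrier_vec p"
  shows "bil (M * F) x y = bil M x (F *\<^sub>v y)"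
  using assms M by (simp add: bil_def)

text \<open>The outer factors may differ, because the gain formula involves B^T P A besides B^T P
  B.\<close>

lemma bil_congruence:
  assumes "F \<in> carrier_mat n p" "G \<in> carrier_mat m q" "x \<in> carrier_vec p" "y \<in> carrier_vec q"
  shows "bil (F\<^sup>T * M * G) x y = bil M (F *\<^sub>v x) (G *\<^sub>v y)"
proof -
  have "bil (F\<^sup>T * M * G) x y = bil F\<^sup>T x (M *\<^sub>v (G *\<^sub>v y))"
    using assms M by (simp add: bil_def assoc_mult_mat_vec[of "F\<^sup>T" p n _ q] assoc_mult_mat_vec[of M n m _ q]
        mult_mat_vec_carrier[of G m q] assoc_mult_mat[of "F\<^sup>T" p n _ m _ q])
  also have "\<dots> = bil F (M *\<^sub>v (G *\<^sub>v y)) x"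
    using assms M transpose_carrier_mat[of "F" n p] transpose_vec_mult_scalar[of F n p x "M *\<^sub>v (G *\<^sub>v y)"]
    by (simp add: bil_def comm_scalar_prod[of x p])
  also have "\<dots> = bil M (F *\<^sub>v x) (G *\<^sub>v y)"
    using assms M by (simp add: bil_def comm_scalar_prod[of _ n])
  finally show ?thesis .
qed

end

lemmas bil_simps = bil_add_left bil_add_right bil_diff_left bil_diff_right bil_smult_left
  bil_smult_right bil_add_mat bil_diff_mat bil_uminus_mat bil_smult_mat bil_congruence

lemma bil_one: "y \<in> carrier_vec n \<Longrightarrow> bil (1\<^sub>m n) x y = x \<bullet> y"
  by (simp add: bil_def)

section \<open>Symmetric and positive definite forms\<close>

lemma symmetric_matrixD:
  assumes "symmetric_matrix n P"
  shows "P \<in> carrier_mat n n" "P\<^sup>T = P"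
  using assms by (auto simp: symmetric_matrix_def)

lemma bil_sym:
  assumes "symmetric_matrix n M" "x \<in> carrier_vec n" "y \<in> carrier_vec n"
  shows "bil M x y = bil M y x"
  using bil_transpose[of M n n y x] assms by (simp add: symmetric_matrix_def)

lemma symmetric_matrixI:
  assumes "M \<in> carrier_mat n n"
    and "\<And>x y. x \<in> carrier_vec n \<Longrightarrow> y \<in> carrier_vec n \<Longrightarrow> bil M x y = bil M y x"
  shows "symmetric_matrix n M"
  unfolding symmetric_matrix_def
  using assms mat_eqI_bil[of "M\<^sup>T" n n M] bil_transpose[OF assms(1)] by auto

lemma pos_definiteD:
  assumes "pos_definite n P"
  shows "symmetric_matrix n P" "P \<in> carrier_mat n n"
    and "x \<in> carrier_vec n \<Longrightarrow> x \<noteq> 0\<^sub>v n \<Longrightarrow> bil P x x > 0"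
    and "x \<in> carrier_vec n \<Longrightarrow> bil P x x \<ge> 0"
proof -
  show "symmetric_matrix n P" "P \<in> carrier_mat n n"
    and *: "x \<in> carrier_vec n \<Longrightarrow> x \<noteq> 0\<^sub>v n \<Longrightarrow> bil P x x > 0"
    using assms by (auto simp: pos_definite_def symmetric_matrix_def bil_def)
  then show "x \<in> carrier_vec n \<Longrightarrow> bil P x x \<ge> 0"
    by (cases "x = 0\<^sub>v n") (auto simp: bil_def intro: less_imp_le)
qed

lemma scalar_prod_self_eq_sum: "x \<in> carrier_vec n \<Longrightarrow> x \<bullet> x = (\<Sum>i<n. (x $ i)\<^sup>2)" for x :: "real vec"
  by (auto simp: scalar_prod_def power2_eq_square atLeast0LessThan)

lemma scalar_prod_self_nonneg: "x \<bullet> x \<ge> 0" for x :: "real vec"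
  by (auto simp: scalar_prod_def intro: sum_nonneg)

lemma scalar_prod_self_pos:
  fixes x :: "real vec"
  assumes "x \<in> carrier_vec n" "x \<noteq> 0\<^sub>v n"
  shows "x \<bullet> x > 0"
proof -
  obtain i where i: "i < n" "x $ i \<noteq> 0" using assms by (metis carrier_vecD eq_vecI index_zero_vec)
  have "(x $ i)\<^sup>2 \<le> (\<Sum>i<n. (x $ i)\<^sup>2)" by (rule member_le_sum) (use i in auto)
  moreover have "(x $ i)\<^sup>2 > 0" using i by simp
  ultimately show ?thesis using scalar_prod_self_eq_sum[OF assms(1)] by linarith
qed

subsection \<open>Rayleigh quotients and singular values\<close>

lemma bil_bounded:
  assumes M: "M \<in> carrier_mat n n"
  obtains C where "C > 0" "\<And>x. x \<in> carrier_vec n \<Longrightarrow> \<bar>bil M x x\<bar> \<le> C * (x \<bullet> x)"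
proof
  let ?C = "(\<Sum>i<n. \<Sum>j<n. \<bar>M $$ (i,j)\<bar>)"
  \<comment> \<open>The added 1 keeps the constant positive for the zero matrix too, so that it can
    be inverted later.\<close>
  show "?C + 1 > 0" by (smt (verit) sum_nonneg abs_ge_zero)
  fix x :: "real vec" assume x: "x \<in> carrier_vec n"
  have sq: "(x $ i)\<^sup>2 \<le> x \<bullet> x" if "i < n" for i
    unfolding scalar_prod_self_eq_sum[OF x] by (rule member_le_sum) (use that in auto)
  have xx: "\<bar>x $ i\<bar> * \<bar>x $ j\<bar> \<le> x \<bullet> x" if "i < n" "j < n" for i j
  proof -
    have "2 * (\<bar>x $ i\<bar> * \<bar>x $ j\<bar>) \<le> (x $ i)\<^sup>2 + (x $ j)\<^sup>2"
      using sum_squares_bound[of "\<bar>x $ i\<bar>" "\<bar>x $ j\<bar>"] by simp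
    then show ?thesis using sq[OF that(1)] sq[OF that(2)] by linarith
  qed
  have "\<bar>bil M x x\<bar> \<le> (\<Sum>i<n. \<Sum>j<n. \<bar>x $ i * M $$ (i,j) * x $ j\<bar>)"
    unfolding bil_sum[OF M x x] by (intro order_trans[OF sum_abs] sum_mono sum_abs)
  also have "\<dots> \<le> (\<Sum>i<n. \<Sum>j<n. \<bar>M $$ (i,j)\<bar> * (x \<bullet> x))"
    by (intro sum_mono)
      (use xx in \<open>auto simp: abs_mult mult.assoc mult.left_commute[of "\<bar>x $ _\<bar>"] intro!: mult_left_mono\<close>)
  also have "\<dots> = ?C * (x \<bullet> x)" by (simp add: sum_distrib_right)
  also have "\<dots> \<le> (?C + 1) * (x \<bullet> x)" using scalar_prod_self_nonneg[of x] by (simp add: algebra_simps)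
  finally show "\<bar>bil M x x\<bar> \<le> (?C + 1) * (x \<bullet> x)" .
qed

text \<open>Serves twice: for coercivity below, and to show that the inverse in
  \<open>gain_update\<close> is a genuine one.\<close>

lemma mat_inverse_of_inj:
  fixes M :: "real mat"
  assumes M: "M \<in> carrier_mat n n"
    and inj: "\<And>v. v \<in> carrier_vec n \<Longrightarrow> M *\<^sub>v v = 0\<^sub>v n \<Longrightarrow> v = 0\<^sub>v n"
  obtains N where "mat_inverse M = Some N" "N \<in> carrier_mat n n" "M * N = 1\<^sub>m n" "N * M = 1\<^sub>m n"
proof -
  have "det M \<noteq> 0" using inj by (auto simp: det_0_iff_vec_prod_zero_field[OF M])
  from det_non_zero_imp_unit[OF M this] mat_inverse(1)[OF M]
  obtain N where "mat_inverse M = Some N" by (metis option.exhaust)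
  with mat_inverse(2)[OF M this] that show thesis by blast
qed

text \<open>With $C$ bounding $N$, evaluating the form at $x - C^{-1} N x$ gives
  $C x^T N x \ge |N x|^2$, so that an injective positive semidefinite form is coercive.\<close>

lemma coercive_of_psd_inj:
  assumes N: "symmetric_matrix n N"
    and psd: "\<And>x. x \<in> carrier_vec n \<Longrightarrow> bil N x x \<ge> 0"
    and inj: "\<And>v. v \<in> carrier_vec n \<Longrightarrow> N *\<^sub>v v = 0\<^sub>v n \<Longrightarrow> v = 0\<^sub>v n"
  obtains d where "d > 0" "\<And>x. x \<in> carrier_vec n \<Longrightarrow> bil N x x \<ge> d * (x \<bullet> x)"
proof -
  note Nc[simp] = symmetric_matrixD(1)[OF N]
  obtain C where C: "C > 0" "\<And>x. x \<in> carrier_vec n \<Longrightarrow> \<bar>bil N x x\<bar> \<le> C * (x \<bullet> x)"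
    using bil_bounded[OF Nc] by blast
  obtain L where L[simp]: "L \<in> carrier_mat n n" and LN: "L * N = 1\<^sub>m n"
    using mat_inverse_of_inj[OF Nc inj] by metis
  \<comment> \<open>D bounds |L y|^2 by a multiple of |y|^2; with y = N x this controls x by N x.
    The identity in the middle gives the Gram matrix the shape of a congruence.\<close>
  obtain D where D: "D > 0" "\<And>x. x \<in> carrier_vec n \<Longrightarrow> \<bar>bil (L\<^sup>T * 1\<^sub>m n * L) x x\<bar> \<le> D * (x \<bullet> x)"
    using bil_bounded[of "L\<^sup>T * 1\<^sub>m n * L" n] by (metis L mult_carrier_mat one_carrier_mat transpose_carrier_mat)
  show thesis
  proof
    show "1 / (C * D) > 0" using C D by simp
    fix x :: "real vec" assume x[simp]: "x \<in> carrier_vec n"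
    define y where "y = N *\<^sub>v x"
    have y[simp]: "y \<in> carrier_vec n" by (simp add: y_def mult_mat_vec_carrier[of _ n n])
    have "x = L *\<^sub>v y"
      unfolding y_def by (subst assoc_mult_mat_vec[symmetric, OF L Nc x]) (simp add: LN)
    moreover have "bil (L\<^sup>T * 1\<^sub>m n * L) y y = bil (1\<^sub>m n) (L *\<^sub>v y) (L *\<^sub>v y)"
      by (rule bil_congruence[OF one_carrier_mat L L y y])
    ultimately have "x \<bullet> x = bil (L\<^sup>T * 1\<^sub>m n * L) y y"
      by (simp add: bil_one mult_mat_vec_carrier[OF L y])
    then have xy: "x \<bullet> x \<le> D * (y \<bullet> y)" using D(2)[OF y] by linarith
    have Nyx: "bil N y x = y \<bullet> y" by (simp add: bil_def y_def)
    have "0 \<le> bil N (x - (1/C) \<cdot>\<^sub>v y) (x - (1/C) \<cdot>\<^sub>v y)" by (rule psd) simp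
    also have "\<dots> = bil N x x - 2 * (1/C) * (y \<bullet> y) + (1/C) * ((1/C) * bil N y y)"
      using bil_sym[OF N x y] Nyx
      by (simp add: bil_diff_left[OF Nc] bil_diff_right[OF Nc] bil_smult_left[OF Nc] bil_smult_right[OF Nc]
          diff_divide_distrib)
    also have "(1/C) * ((1/C) * bil N y y) \<le> (1/C) * (y \<bullet> y)"
    proof -
      have "bil N y y \<le> C * (y \<bullet> y)" using C(2)[OF y] by simp
      then have "(1/C) * bil N y y \<le> y \<bullet> y" using C(1) by (simp add: field_simps)
      then show ?thesis using C(1) by (intro mult_left_mono) auto
    qed
    finally have "(y \<bullet> y) / C \<le> bil N x x" by simp
    moreover have "1 / (C * D) * (x \<bullet> x) \<le> (y \<bullet> y) / C"
      using xy C(1) D(1) by (simp add: field_simps)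
    ultimately show "1 / (C * D) * (x \<bullet> x) \<le> bil N x x" by linarith
  qed
qed

text \<open>Let \<nu> be the supremum of the form on the unit sphere. Then \<nu> I - M is positive
  semidefinite; were \<nu> no eigenvalue, it would be injective, hence coercive, and the supremum
  would drop below \<nu>. That the supremum is attained never has to be shown beforehand.\<close>

lemma rayleigh_max_eigenvalue:
  assumes M: "symmetric_matrix n M" and n: "n > 0"
  obtains \<nu> where "eigenvalue M \<nu>" "\<And>x. x \<in> carrier_vec n \<Longrightarrow> bil M x x \<le> \<nu> * (x \<bullet> x)"
proof -
  note Mc[simp] = symmetric_matrixD(1)[OF M]
  define T where "T = {bil M x x | x. x \<in> carrier_vec n \<and> x \<bullet> x = 1}"
  define \<nu> where "\<nu> = Sup T"
  obtain C where C: "C > 0" "\<And>x. x \<in> carrier_vec n \<Longrightarrow> \<bar>bil M x x\<bar> \<le> C * (x \<bullet> x)"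
    using bil_bounded[OF Mc] by blast
  have bdd: "bdd_above T" 
    unfolding T_def by (rule bdd_aboveI[of _ C]) (use C(2) in force)
  have ne: "T \<noteq> {}" using n by (auto simp: T_def intro!: exI[of _ "unit_vec n 0"])
  have scale: "bil M x x \<le> c * (x \<bullet> x)" 
    if T: "\<And>t. t \<in> T \<Longrightarrow> t \<le> c" and x: "x \<in> carrier_vec n" for x c
  proof (cases "x = 0\<^sub>v n")
    case True
    then show ?thesis by (simp add: bil_def mult_mat_vec_carrier[of _ n n])
  next
    case False
    then have pos: "x \<bullet> x > 0" using scalar_prod_self_pos x by blast
    define s where "s = 1 / sqrt (x \<bullet> x)"
    have s2: "s * s = 1 / (x \<bullet> x)" using pos by (simp add: s_def)
    have "bil M (s \<cdot>\<^sub>v x) (s \<cdot>\<^sub>v x) \<in> T"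
      unfolding T_def using x s2 pos by (auto intro!: exI[of _ "s \<cdot>\<^sub>v x"] simp: field_simps)
    then have "bil M (s \<cdot>\<^sub>v x) (s \<cdot>\<^sub>v x) \<le> c" by (rule T)
    also have "bil M (s \<cdot>\<^sub>v x) (s \<cdot>\<^sub>v x) = (s * s) * bil M x x"
      using x by (simp add: bil_smult_left[OF Mc] bil_smult_right[OF Mc])
    finally show ?thesis using pos by (simp add: s2 field_simps)
  qed
  have le: "bil M x x \<le> \<nu> * (x \<bullet> x)" if "x \<in> carrier_vec n" for x
    by (rule scale[OF _ that]) (simp add: \<nu>_def cSup_upper bdd)
  have "eigenvalue M \<nu>"
  proof (rule ccontr)
    assume no: "\<not> eigenvalue M \<nu>"
    define N where "N = \<nu> \<cdot>\<^sub>m 1\<^sub>m n - M"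
    have bilN: "bil N x y = \<nu> * (x \<bullet> y) - bil M x y" if "x \<in> carrier_vec n" "y \<in> carrier_vec n" for x y
      using that by (simp add: N_def bil_diff_mat[of _ n n] bil_smult_mat[of _ n n] bil_one)
    have Nc: "N \<in> carrier_mat n n" by (simp add: N_def minus_carrier_mat)
    have Nsym: "symmetric_matrix n N"
      by (rule symmetric_matrixI[OF Nc]) (simp add: bilN bil_sym[OF M] comm_scalar_prod[of _ n])
    have inj: "v = 0\<^sub>v n" if v: "v \<in> carrier_vec n" "N *\<^sub>v v = 0\<^sub>v n" for v
    proof (rule ccontr)
      assume v0: "v \<noteq> 0\<^sub>v n"
      have "M *\<^sub>v v = \<nu> \<cdot>\<^sub>v v"
      proof (rule eq_vecI)
        fix i assume i: "i < dim_vec (\<nu> \<cdot>\<^sub>v v)"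
        then have i': "i < n" using v by simp
        have "(N *\<^sub>v v) $ i = 0" using v i by simp
        moreover have "(N *\<^sub>v v) $ i = \<nu> * v $ i - (M *\<^sub>v v) $ i"
          using i' v(1) bilN[of "unit_vec n i" v] Nc by (simp add: bil_def mult_mat_vec_carrier[of _ n n])
        ultimately show "(M *\<^sub>v v) $ i = (\<nu> \<cdot>\<^sub>v v) $ i" using i by simp
      qed (use v Mc in \<open>auto simp del: Mc\<close>)
      then show False using no v v0 Mc by (auto simp: eigenvalue_def eigenvector_def)
    qed
    obtain d where d: "d > 0" "\<And>x. x \<in> carrier_vec n \<Longrightarrow> bil N x x \<ge> d * (x \<bullet> x)"
      by (rule coercive_of_psd_inj[OF Nsym _ inj]) (use le bilN in auto)
    \<comment> \<open>On the unit sphere the form of M is \<nu> minus that of N, so coercivity of N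
      lowers every value by at least d.\<close>
    have "t \<le> \<nu> - d" if "t \<in> T" for t
      using that d(2) bilN by (force simp: T_def)
    then have "\<nu> \<le> \<nu> - d"
      using cSup_least[OF ne] \<nu>_def by metis
    then show False using d(1) by simp
  qed
  then show thesis using that le by blast
qed

lemma finite_singular_values:
  assumes "M \<in> carrier_mat n n"
  shows "finite (singular_values M)"
  using card_finite_spectrum(1)[of "M\<^sup>T * M" n] assms by (simp add: singular_values_def)

text \<open>By symmetry the Gram matrix is the square of M, so it has the squared eigenvalue on the
  same vector. This places the absolute value of an eigenvalue between \<open>sigma_min\<close> and
  \<open>sigma_max\<close>.\<close>

lemma abs_eigenvalue_singular_value:
  assumes M: "symmetric_matrix n M" and ev: "eigenvalue M \<nu>"
  shows "\<bar>\<nu>\<bar> \<in> singular_values M"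
proof -
  note Mc = symmetric_matrixD[OF M]
  obtain v where v: "v \<in> carrier_vec n" "v \<noteq> 0\<^sub>v n" "M *\<^sub>v v = \<nu> \<cdot>\<^sub>v v"
    using ev Mc(1) by (auto simp: eigenvalue_def eigenvector_def)
  have "(M\<^sup>T * M) *\<^sub>v v = \<nu>\<^sup>2 \<cdot>\<^sub>v v"
    using v Mc mult_mat_vec[OF Mc(1) v(1)]
    by (simp add: assoc_mult_mat_vec[of _ n n _ n] smult_smult_assoc power2_eq_square)
  then have "\<nu>\<^sup>2 \<in> spectrum (M\<^sup>T * M)"
    using v Mc by (auto simp: spectrum_def eigenvalue_def eigenvector_def)
  then have "sqrt (\<nu>\<^sup>2) \<in> singular_values M" unfolding singular_values_def by (rule imageI)
  then show ?thesis by simp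
qed

lemma bil_le_sigma_max:
  assumes M: "symmetric_matrix n M" and n: "n > 0"
  shows "\<forall>x \<in> carrier_vec n. bil M x x \<le> sigma_max M * (x \<bullet> x)" and "sigma_max M \<ge> 0"
proof -
  obtain \<nu> where \<nu>: "eigenvalue M \<nu>" "\<And>x. x \<in> carrier_vec n \<Longrightarrow> bil M x x \<le> \<nu> * (x \<bullet> x)"
    using rayleigh_max_eigenvalue[OF M n] by blast
  have le: "\<bar>\<nu>\<bar> \<le> sigma_max M"
    unfolding sigma_max_def
    by (intro Max_ge finite_singular_values[OF symmetric_matrixD(1)[OF M]]
        abs_eigenvalue_singular_value[OF M \<nu>(1)])
  then show "sigma_max M \<ge> 0" by simp
  show "\<forall>x \<in> carrier_vec n. bil M x x \<le> sigma_max M * (x \<bullet> x)"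
  proof
    fix x :: "real vec" assume "x \<in> carrier_vec n"
    then have "bil M x x \<le> \<nu> * (x \<bullet> x)" by (rule \<nu>)
    also have "\<dots> \<le> sigma_max M * (x \<bullet> x)"
      using le scalar_prod_self_nonneg[of x] by (intro mult_right_mono) auto
    finally show "bil M x x \<le> sigma_max M * (x \<bullet> x)" .
  qed
qed

text \<open>The largest eigenvalue \<nu> of -S gives the smallest eigenvalue -\<nu> of S.
  Definiteness makes it positive, hence equal to its absolute value, which is a singular value; for
  S = -I the inequality would fail.\<close>

lemma bil_ge_sigma_min:
  assumes S: "pos_definite n S" and n: "n > 0" and x: "x \<in> carrier_vec n"
  shows "sigma_min S * (x \<bullet> x) \<le> bil S x x"
proof -
  note Sc = pos_definiteD(2)[OF S] and Ss = pos_definiteD(1)[OF S]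
  have "symmetric_matrix n (- S)"
    by (rule symmetric_matrixI) (use Sc in \<open>simp_all add: bil_uminus_mat[OF Sc] bil_sym[OF Ss]\<close>)
  then obtain \<nu> where \<nu>: "eigenvalue (- S) \<nu>" "\<And>x. x \<in> carrier_vec n \<Longrightarrow> bil (- S) x x \<le> \<nu> * (x \<bullet> x)"
    using rayleigh_max_eigenvalue[OF _ n] by metis
  obtain v where v: "v \<in> carrier_vec n" "v \<noteq> 0\<^sub>v n" "- S *\<^sub>v v = \<nu> \<cdot>\<^sub>v v"
    using \<nu>(1) Sc by (auto simp: eigenvalue_def eigenvector_def)
  have "S *\<^sub>v v = - (- S *\<^sub>v v)" using v(1) Sc by simp
  also have "\<dots> = (- \<nu>) \<cdot>\<^sub>v v" unfolding v(3) using v(1) by (intro eq_vecI) auto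
  finally have Sv: "S *\<^sub>v v = (- \<nu>) \<cdot>\<^sub>v v" .
  then have "eigenvalue S (- \<nu>)" using v Sc by (auto simp: eigenvalue_def eigenvector_def)
  then have mem: "\<bar>- \<nu>\<bar> \<in> singular_values S" by (rule abs_eigenvalue_singular_value[OF Ss])
  have "0 < bil S v v" using pos_definiteD(3)[OF S] v by blast
  also have "\<dots> = (- \<nu>) * (v \<bullet> v)" unfolding bil_def Sv using v(1) by simp
  finally have "- \<nu> > 0" using scalar_prod_self_nonneg[of v] by (simp add: mult_less_0_iff)
  moreover have "sigma_min S \<le> \<bar>- \<nu>\<bar>"
    unfolding sigma_min_def by (intro Min_le finite_singular_values[OF Sc] mem)
  ultimately have "sigma_min S * (x \<bullet> x) \<le> - \<nu> * (x \<bullet> x)"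
    using scalar_prod_self_nonneg[of x] by (intro mult_right_mono) auto
  also have "\<dots> \<le> bil S x x" using \<nu>(2)[OF x] bil_uminus_mat[OF Sc x x] by simp
  finally show ?thesis .
qed

subsection \<open>Stability and the discrete Lyapunov equation\<close>

text \<open>The radius is attained at an eigenvalue, the dimension being positive, so strict bounds
  on all eigenvalues give a strict bound on their maximum.\<close>

lemma real_spectral_radius_less_iff:
  assumes M: "M \<in> carrier_mat n n" and n: "n > 0"
  shows "real_spectral_radius M < c \<longleftrightarrow>
    (\<forall>\<mu>. eigenvalue (map_mat complex_of_real M) \<mu> \<longrightarrow> norm \<mu> < c)"
proof -
  have Mc: "map_mat complex_of_real M \<in> carrier_mat n n" using M by simp
  from spectral_radius_mem_max[OF Mc n] show ?thesis
    unfolding real_spectral_radius_def by (fastforce simp: spectrum_def)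
qed

lemma smult_pow_mat:
  fixes M :: "'a :: comm_semiring_1 mat"
  assumes M: "M \<in> carrier_mat n n"
  shows "(c \<cdot>\<^sub>m M) ^\<^sub>m k = c ^ k \<cdot>\<^sub>m (M ^\<^sub>m k)"
proof (induction k)
  case 0
  show ?case using M by (auto intro!: eq_matI)
next
  case (Suc k)
  have Mk: "M ^\<^sub>m k \<in> carrier_mat n n" using M by simp
  show ?case
    using M Mk by (simp add: Suc mult_smult_distrib[of _ n n _ n] mult_smult_assoc_mat[of _ n n _ n])
      (auto intro!: eq_matI simp: mult_ac)
qed

text \<open>Dividing by c turns an eigenvalue of c M into one of M with the same eigenvector. Used
  to leave room for geometric decay of powers, and for the initial loop.\<close>

lemma real_spectral_radius_smult_less:
  assumes M: "M \<in> carrier_mat n n" and n: "n > 0" and c: "c > 0"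
    and \<rho>: "real_spectral_radius M < r"
  shows "real_spectral_radius (c \<cdot>\<^sub>m M) < c * r"
proof -
  have cM: "c \<cdot>\<^sub>m M \<in> carrier_mat n n" using M by simp
  show ?thesis unfolding real_spectral_radius_less_iff[OF cM n]
  proof (intro allI impI)
    fix \<mu> assume "eigenvalue (map_mat complex_of_real (c \<cdot>\<^sub>m M)) \<mu>"
    then obtain v where v: "v \<in> carrier_vec n" "v \<noteq> 0\<^sub>v n"
      "map_mat complex_of_real (c \<cdot>\<^sub>m M) *\<^sub>v v = \<mu> \<cdot>\<^sub>v v"
      using M by (auto simp: eigenvalue_def eigenvector_def)
    have "map_mat complex_of_real (c \<cdot>\<^sub>m M) *\<^sub>v v = of_real c \<cdot>\<^sub>v (map_mat complex_of_real M *\<^sub>v v)"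
      using M v(1) by (intro eq_vecI) (auto simp: scalar_prod_def sum_distrib_left mult.assoc)
    then have eq: "\<mu> \<cdot>\<^sub>v v = of_real c \<cdot>\<^sub>v (map_mat complex_of_real M *\<^sub>v v)" using v by simp
    have "map_mat complex_of_real M *\<^sub>v v = (\<mu> / of_real c) \<cdot>\<^sub>v v"
    proof (rule eq_vecI)
      fix i assume "i < dim_vec ((\<mu> / of_real c) \<cdot>\<^sub>v v)"
      then show "(map_mat complex_of_real M *\<^sub>v v) $ i = ((\<mu> / of_real c) \<cdot>\<^sub>v v) $ i"
        using arg_cong[OF eq, of "\<lambda>w. w $ i"] c v(1) M by (simp add: field_simps)
    qed (use M v in auto)
    then have "eigenvalue (map_mat complex_of_real M) (\<mu> / of_real c)"
      using M v by (auto simp: eigenvalue_def eigenvector_def)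
    then have "norm (\<mu> / of_real c) < r" using \<rho> real_spectral_radius_less_iff[OF M n] by blast
    then show "norm \<mu> < c * r" using c by (simp add: norm_divide field_simps)
  qed
qed

text \<open>A radius below 1 first yields only bounded powers. Applied to G = F / r with r between
  the radius of F and 1, boundedness becomes the decay rate r^k for F.\<close>

lemma stable_pow_tendsto_0:
  assumes F: "F \<in> carrier_mat n n" and n: "n > 0"
    and stable: "real_spectral_radius F < 1" and ij: "i < n" "j < n"
  shows "(\<lambda>k. (F ^\<^sub>m k) $$ (i,j)) \<longlonglongrightarrow> 0"
proof -
  \<comment> \<open>The midpoint between the radius and 1; the maximum with 1/2 makes positivity
    immediate.\<close>
  define r where "r = max (1/2) ((1 + real_spectral_radius F) / 2)"
  have r: "0 < r" "r < 1" "real_spectral_radius F < r"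
    using stable by (auto simp: r_def less_max_iff_disj)
  define G where "G = (1/r) \<cdot>\<^sub>m F"
  have G: "G \<in> carrier_mat n n" using F by (simp add: G_def)
  have "real_spectral_radius G < 1"
    using real_spectral_radius_smult_less[OF F n _ r(3), of "1/r"] r(1) by (simp add: G_def)
  then obtain C where C: "\<And>k. norm_bound (map_mat complex_of_real G ^\<^sub>m k) C"
    using spectral_radius_jnf_norm_bound_less_1_upper_triangular[of "map_mat complex_of_real G" n] G
    unfolding real_spectral_radius_def by auto
  have bound: "\<bar>(F ^\<^sub>m k) $$ (i,j)\<bar> \<le> C * r ^ k" for k
  proof -
    have Gk: "G ^\<^sub>m k \<in> carrier_mat n n" and Fk: "F ^\<^sub>m k \<in> carrier_mat n n" using F G by auto
    have entry: "norm (H $$ (i,j)) \<le> C" if "norm_bound H C" "H \<in> carrier_mat n n" for H :: "complex mat"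
      using that ij by (auto simp: norm_bound_def)
    have "norm ((map_mat complex_of_real (G ^\<^sub>m k)) $$ (i,j)) \<le> C"
    proof (rule entry)
      show "norm_bound (map_mat complex_of_real (G ^\<^sub>m k)) C"
        using C[of k] by (simp only: of_real_hom.mat_hom_pow[OF G])
    qed (use Gk in simp)
    moreover have "map_mat complex_of_real (G ^\<^sub>m k) $$ (i,j) = complex_of_real ((G ^\<^sub>m k) $$ (i,j))"
      by (rule index_map_mat) (simp_all only: carrier_matD[OF Gk] ij)
    ultimately have "\<bar>(G ^\<^sub>m k) $$ (i,j)\<bar> \<le> C" by simp
    also have "(G ^\<^sub>m k) $$ (i,j) = (F ^\<^sub>m k) $$ (i,j) / r ^ k"
      unfolding G_def smult_pow_mat[OF F]
      by (subst index_smult_mat) (simp_all only: carrier_matD[OF Fk] ij, simp add: power_one_over)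
    finally show ?thesis using r(1) by (simp add: field_simps)
  qed
  have "(\<lambda>k. C * r ^ k) \<longlonglongrightarrow> C * 0" using r by (intro tendsto_intros LIMSEQ_realpow_zero) auto
  then have "(\<lambda>k. C * r ^ k) \<longlonglongrightarrow> 0" by simp
  moreover have "norm ((F ^\<^sub>m k) $$ (i,j)) \<le> norm (C * r ^ k) * 1" for k
    using bound[of k] unfolding real_norm_def by linarith
  ultimately show ?thesis by (blast intro: tendsto_0_le always_eventually)
qed

lemma index_mult_mat_vec_sum:
  assumes "G \<in> carrier_mat n m" "z \<in> carrier_vec m" "i < n"
  shows "(G *\<^sub>v z) $ i = (\<Sum>j<m. G $$ (i,j) * z $ j)"
  using assms by (auto simp: scalar_prod_def atLeast0LessThan)

lemma stable_bil_pow_tendsto_0: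
  assumes F: "F \<in> carrier_mat n n" and n: "n > 0"
    and stable: "real_spectral_radius F < 1" and M: "M \<in> carrier_mat n n"
    and x: "x \<in> carrier_vec n" and y: "y \<in> carrier_vec n"
  shows "(\<lambda>k. bil M (F ^\<^sub>m k *\<^sub>v x) (F ^\<^sub>m k *\<^sub>v y)) \<longlonglongrightarrow> 0"
proof -
  have Fk: "F ^\<^sub>m k \<in> carrier_mat n n" for k using F by simp
  have comp: "(\<lambda>k. (F ^\<^sub>m k *\<^sub>v z) $ i) \<longlonglongrightarrow> 0" if "z \<in> carrier_vec n" "i < n" for z i
  proof -
    have "(F ^\<^sub>m k *\<^sub>v z) $ i = (\<Sum>j<n. (F ^\<^sub>m k) $$ (i,j) * z $ j)" for k
      by (rule index_mult_mat_vec_sum[OF Fk that])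
    then show ?thesis
      using that by (auto intro!: tendsto_null_sum tendsto_mult_left_zero stable_pow_tendsto_0[OF F n stable])
  qed
  have "bil M (F ^\<^sub>m k *\<^sub>v x) (F ^\<^sub>m k *\<^sub>v y) =
      (\<Sum>i<n. \<Sum>j<n. (F ^\<^sub>m k *\<^sub>v x) $ i * M $$ (i,j) * (F ^\<^sub>m k *\<^sub>v y) $ j)" for k
    using bil_sum[OF M] mult_mat_vec_carrier[OF Fk] x y by blast
  then show ?thesis
    using x y by (auto intro!: tendsto_null_sum tendsto_mult_zero tendsto_mult_left_zero comp simp del: index_mult_mat_vec)
qed

text \<open>Peels off the innermost factor, so that inductions on k with arbitrary x can pass from x
  to F x.\<close>

lemma pow_mat_Suc_mult_vec:
  assumes "F \<in> carrier_mat n n" "x \<in> carrier_vec n"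
  shows "F ^\<^sub>m Suc k *\<^sub>v x = F ^\<^sub>m k *\<^sub>v (F *\<^sub>v x)"
  using assms by (simp add: assoc_mult_mat_vec[of _ n n _ n])

text \<open>The value is constant along trajectories, which tend to 0. The difference of two
  solutions of one Lyapunov equation is such a form, since the source term cancels.\<close>

lemma stable_invariant_form_zero:
  assumes F: "F \<in> carrier_mat n n" and n: "n > 0"
    and stable: "real_spectral_radius F < 1" and D: "D \<in> carrier_mat n n"
    and inv: "\<And>x y. x \<in> carrier_vec n \<Longrightarrow> y \<in> carrier_vec n \<Longrightarrow> bil D x y = bil D (F *\<^sub>v x) (F *\<^sub>v y)"
    and x: "x \<in> carrier_vec n" and y: "y \<in> carrier_vec n"
  shows "bil D x y = 0"
proof -
  have "bil D x y = bil D (F ^\<^sub>m k *\<^sub>v x) (F ^\<^sub>m k *\<^sub>v y)" for k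
    using x y
  proof (induction k arbitrary: x y)
    case (Suc k)
    then show ?case
      using inv[of x y] F by (simp add: pow_mat_Suc_mult_vec[OF F] mult_mat_vec_carrier[OF F] del: pow_mat.simps)
  qed (use F in auto)
  then have "(\<lambda>k::nat. bil D x y) \<longlonglongrightarrow> 0"
    using stable_bil_pow_tendsto_0[OF F n stable D x y] by simp
  then show ?thesis by (simp add: LIMSEQ_const_iff)
qed

text \<open>The form of P decreases along trajectories towards the limit 0, hence is nonnegative;
  one further use of the equation adds the strictly positive term from S.\<close>

lemma stable_stein_pos_definite:
  assumes F: "F \<in> carrier_mat n n" and n: "n > 0"
    and stable: "real_spectral_radius F < 1"
    and P: "symmetric_matrix n P" and S: "pos_definite n S"
    and stein: "\<And>x. x \<in> carrier_vec n \<Longrightarrow> bil P x x = bil S x x + bil P (F *\<^sub>v x) (F *\<^sub>v x)"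
  shows "pos_definite n P"
proof -
  note Pc = symmetric_matrixD(1)[OF P]
  have dec: "bil P (F ^\<^sub>m k *\<^sub>v x) (F ^\<^sub>m k *\<^sub>v x) \<le> bil P x x" if x: "x \<in> carrier_vec n" for k x
    using x
  proof (induction k arbitrary: x)
    case (Suc k)
    have "bil P (F ^\<^sub>m k *\<^sub>v (F *\<^sub>v x)) (F ^\<^sub>m k *\<^sub>v (F *\<^sub>v x)) \<le> bil P (F *\<^sub>v x) (F *\<^sub>v x)"
      using Suc F by simp
    then show ?case
      using stein[of x] Suc.prems pos_definiteD(4)[OF S Suc.prems]
      by (simp add: pow_mat_Suc_mult_vec[OF F] del: pow_mat.simps)
  qed (use F in auto)
  have nonneg: "0 \<le> bil P x x" if "x \<in> carrier_vec n" for x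
    by (rule LIMSEQ_le_const2[OF stable_bil_pow_tendsto_0[OF F n stable Pc that that]])
      (use dec[OF that] in auto)
  show ?thesis
    unfolding pos_definite_def bil_def[symmetric]
  proof (intro conjI P ballI impI)
    fix x :: "real vec" assume x: "x \<in> carrier_vec n" "x \<noteq> 0\<^sub>v n"
    then show "0 < bil P x x"
      using stein[of x] pos_definiteD(3)[OF S x] nonneg[of "F *\<^sub>v x"] F by simp
  qed
qed

text \<open>Writing a complex eigenvector as $a + i b$, the sum $V(a) + V(b)$ of the
  quadratic form $V$ of $P$ is multiplied by the squared modulus of the eigenvalue.\<close>

lemma lyapunov_decrease_stable:
  assumes F: "F \<in> carrier_mat n n" and n: "n > 0" and P: "pos_definite n P"
    and dec: "\<And>x. x \<in> carrier_vec n \<Longrightarrow> x \<noteq> 0\<^sub>v n \<Longrightarrow> bil P (F *\<^sub>v x) (F *\<^sub>v x) < bil P x x"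
  shows "real_spectral_radius F < 1"
  unfolding real_spectral_radius_less_iff[OF F n]
proof (intro allI impI)
  fix \<mu> assume "eigenvalue (map_mat complex_of_real F) \<mu>"
  then obtain v where v: "v \<in> carrier_vec n" "v \<noteq> 0\<^sub>v n"
    "map_mat complex_of_real F *\<^sub>v v = \<mu> \<cdot>\<^sub>v v"
    using F by (auto simp: eigenvalue_def eigenvector_def)
  define a b where "a = map_vec Re v" and "b = map_vec Im v"
  have ab[simp]: "a \<in> carrier_vec n" "b \<in> carrier_vec n" using v by (auto simp: a_def b_def)
  note Pc = pos_definiteD(2)[OF P]
  have comp: "(\<Sum>j = 0..<n. complex_of_real (F $$ (i,j)) * v $ j) = \<mu> * v $ i" if "i < n" for i
    using arg_cong[OF v(3), of "\<lambda>w. w $ i"] that F v(1) by (auto simp: scalar_prod_def)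
  have Fa: "F *\<^sub>v a = Re \<mu> \<cdot>\<^sub>v a - Im \<mu> \<cdot>\<^sub>v b"
    using F v(1) arg_cong[OF comp, of _ Re]
    by (intro eq_vecI) (auto simp: scalar_prod_def a_def b_def)
  have Fb: "F *\<^sub>v b = Im \<mu> \<cdot>\<^sub>v a + Re \<mu> \<cdot>\<^sub>v b"
    using F v(1) arg_cong[OF comp, of _ Im]
    by (intro eq_vecI) (auto simp: scalar_prod_def a_def b_def)
  have sym: "bil P b a = bil P a b" by (rule bil_sym[OF pos_definiteD(1)[OF P]]) simp_all
  \<comment> \<open>The mixed terms in a and b have opposite signs in the two summands and cancel by
    symmetry of P.\<close>
  have "bil P (F *\<^sub>v a) (F *\<^sub>v a) + bil P (F *\<^sub>v b) (F *\<^sub>v b) = (norm \<mu>)\<^sup>2 * (bil P a a + bil P b b)"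
    unfolding Fa Fb cmod_power2
    by (simp add: bil_simps[OF Pc] sym power2_eq_square algebra_simps)
  moreover have "a \<noteq> 0\<^sub>v n \<or> b \<noteq> 0\<^sub>v n"
  proof (rule ccontr)
    assume "\<not> (a \<noteq> 0\<^sub>v n \<or> b \<noteq> 0\<^sub>v n)"
    then have "a $ i = 0" "b $ i = 0" if "i < n" for i using that by auto
    then have "Re (v $ i) = 0" "Im (v $ i) = 0" if "i < n" for i
      using that v(1) by (auto simp: a_def b_def)
    then have "v = 0\<^sub>v n" using v(1) by (intro eq_vecI) (auto simp: complex_eq_iff)
    then show False using v by simp
  qed
  \<comment> \<open>One of a and b may vanish, as for a real eigenvector, so the weak inequality is
    needed for both and the strict one for the nonzero one.\<close>
  moreover have "bil P (F *\<^sub>v c) (F *\<^sub>v c) \<le> bil P c c \<and> (c \<noteq> 0\<^sub>v n \<longrightarrow> bil P (F *\<^sub>v c) (F *\<^sub>v c) < bil P c c)" 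
    if "c \<in> carrier_vec n" for c
  proof (cases "c = 0\<^sub>v n")
    case True
    moreover have "F *\<^sub>v 0\<^sub>v n = 0\<^sub>v n" using F by (intro eq_vecI) auto
    ultimately show ?thesis by simp
  qed (use dec[OF that] in auto)
  ultimately have "(norm \<mu>)\<^sup>2 * (bil P a a + bil P b b) < bil P a a + bil P b b"
    using ab by (smt (verit))
  moreover have "bil P a a + bil P b b \<ge> 0" using pos_definiteD(4)[OF P] ab by (simp add: add_nonneg_nonneg)
  ultimately have "(norm \<mu>)\<^sup>2 < 1"
    using mult_right_mono[of 1 "(norm \<mu>)\<^sup>2" "bil P a a + bil P b b"] by (metis leD leI mult_1)
  then show "norm \<mu> < 1" by (simp add: power_less_one_iff)
qed

section \<open>Unique solvability of the discrete Lyapunov equation\<close>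

lemma stein_solution_unique:
  assumes F: "F \<in> carrier_mat n n" and n: "n > 0" and stable: "real_spectral_radius F < 1"
    and X: "X \<in> carrier_mat n n" and Y: "Y \<in> carrier_mat n n"
    and steinX: "\<And>x y. x \<in> carrier_vec n \<Longrightarrow> y \<in> carrier_vec n \<Longrightarrow>
      bil X x y = bil S x y + bil X (F *\<^sub>v x) (F *\<^sub>v y)"
    and steinY: "\<And>x y. x \<in> carrier_vec n \<Longrightarrow> y \<in> carrier_vec n \<Longrightarrow>
      bil Y x y = bil S x y + bil Y (F *\<^sub>v x) (F *\<^sub>v y)"
  shows "X = Y"
proof (rule mat_eqI_bil[OF X Y])
  fix x y :: "real vec" assume xy: "x \<in> carrier_vec n" "y \<in> carrier_vec n"
  have "bil (X - Y) x y = 0"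
  proof (rule stable_invariant_form_zero[OF F n stable _ _ xy])
    fix x y :: "real vec" assume "x \<in> carrier_vec n" "y \<in> carrier_vec n"
    then show "bil (X - Y) x y = bil (X - Y) (F *\<^sub>v x) (F *\<^sub>v y)"
      using steinX[of x y] steinY[of x y]
      by (simp add: bil_diff_mat[OF X Y] mult_mat_vec_carrier[OF F])
  qed (use Y in \<open>simp add: minus_carrier_mat\<close>)
  then show "bil X x y = bil Y x y" using xy by (simp add: bil_diff_mat[OF X Y])
qed

text \<open>The partial sums of $\sum_k (F^k)^T S F^k$ increase and are dominated by a multiple of
  $P$, because $S$ is dominated by a multiple of the decrease of $P$ along $F$.\<close>

lemma stein_solution_exists:
  assumes F: "F \<in> carrier_mat n n" and n: "n > 0"
    and S: "pos_definite n S" and P: "pos_definite n P" and d: "d > 0"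
    and dec: "\<And>x. x \<in> carrier_vec n \<Longrightarrow> bil P (F *\<^sub>v x) (F *\<^sub>v x) + d * (x \<bullet> x) \<le> bil P x x"
  obtains X where "symmetric_matrix n X"
    "\<And>x y. x \<in> carrier_vec n \<Longrightarrow> y \<in> carrier_vec n \<Longrightarrow>
      bil X x y = bil S x y + bil X (F *\<^sub>v x) (F *\<^sub>v y)"
proof -
  note Sc = pos_definiteD(2)[OF S] and Pc = pos_definiteD(2)[OF P]
  have Fx: "F *\<^sub>v x \<in> carrier_vec n" if "x \<in> carrier_vec n" for x
    using that F by simp
  obtain C where C: "C > 0" "\<And>x. x \<in> carrier_vec n \<Longrightarrow> \<bar>bil S x x\<bar> \<le> C * (x \<bullet> x)"
    using bil_bounded[OF Sc] by blast
  \<comment> \<open>Horner form of the partial sums: starting from zero, \<open>X k\<close> collects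
    the k terms with exponents below k.\<close>
  define X where "X k = ((\<lambda>X. S + F\<^sup>T * X * F) ^^ k) (0\<^sub>m n n)" for k :: nat
  have X_Suc: "X (Suc k) = S + F\<^sup>T * X k * F" for k by (simp add: X_def)
  have Xc: "X k \<in> carrier_mat n n" for k
  proof (cases k)
    case (Suc l)
    then show ?thesis using X_Suc[of l] F Sc
      by (metis add_carrier_mat carrier_matD(2) carrier_matI index_mult_mat(2,3)
          index_transpose_mat(2) carrier_matD(1))
  qed (simp add: X_def)
  have X0: "bil (X 0) x y = 0" if "x \<in> carrier_vec n" "y \<in> carrier_vec n" for x y
    using that by (simp add: X_def bil_sum[of _ n n])
  have bilX: "bil (X (Suc k)) x y = bil S x y + bil (X k) (F *\<^sub>v x) (F *\<^sub>v y)"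
    if "x \<in> carrier_vec n" "y \<in> carrier_vec n" for k x y
  proof -
    have "F\<^sup>T * X k * F \<in> carrier_mat n n" using F Xc[of k] by auto
    from bil_add_mat[OF Sc this that] show ?thesis
      by (simp add: X_Suc bil_congruence[OF Xc F F that])
  qed
  have sym: "bil (X k) x y = bil (X k) y x" if "x \<in> carrier_vec n" "y \<in> carrier_vec n" for k x y
    using that
  proof (induction k arbitrary: x y)
    case (Suc k)
    then show ?case using bilX Fx bil_sym[OF pos_definiteD(1)[OF S]] by simp
  qed (simp add: X0)
  have mono: "bil (X k) x x \<le> bil (X (Suc k)) x x" if "x \<in> carrier_vec n" for k x
    using that
  proof (induction k arbitrary: x)
    case 0
    then show ?case using bilX[of x x 0] X0 Fx pos_definiteD(4)[OF S] by simp
  next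
    case (Suc k)
    then show ?case using bilX[of x x] Fx by simp
  qed
  \<comment> \<open>The factor C / d arises from S(x) <= C |x|^2 <= (C / d) (V(x) - V(Fx)), V being
    the form of P; the recursion adds the bound at Fx and the V(Fx) terms cancel.\<close>
  have bound: "bil (X k) x x \<le> C / d * bil P x x" if "x \<in> carrier_vec n" for k x
    using that
  proof (induction k arbitrary: x)
    case 0
    then show ?case using X0 pos_definiteD(4)[OF P] C(1) d by simp
  next
    case (Suc k)
    have "bil S x x \<le> C / d * (d * (x \<bullet> x))" using C(2)[OF Suc.prems] d by simp
    also have "\<dots> \<le> C / d * (bil P x x - bil P (F *\<^sub>v x) (F *\<^sub>v x))"
      using dec[OF Suc.prems] C(1) d by (intro mult_left_mono) auto
    finally show ?case
      using Suc.IH[OF Fx[OF Suc.prems]] bilX[OF Suc.prems Suc.prems, of k] by (simp add: right_diff_distrib)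
  qed
  have conv: "convergent (\<lambda>k. bil (X k) x x)" if "x \<in> carrier_vec n" for x
    using incseq_convergent[of "\<lambda>k. bil (X k) x x" "C / d * bil P x x"] mono[OF that] bound[OF that]
    by (metis convergent_def incseq_SucI)
  have conv_entry: "convergent (\<lambda>k. X k $$ (i,j))" if ij: "i < n" "j < n" for i j
  proof -
    let ?e = "unit_vec n :: nat \<Rightarrow> real vec"
    \<comment> \<open>Polarisation: only the quadratic forms are monotone, and this passes
      convergence on to the entries.\<close>
    have "X k $$ (i,j) = (bil (X k) (?e i + ?e j) (?e i + ?e j) - bil (X k) (?e i) (?e i) - bil (X k) (?e j) (?e j)) * (1/2)" for k
      using sym[of "?e i" "?e j" k] bil_unit_vec[OF Xc[of k] ij]
      by (simp add: bil_add_left[OF Xc] bil_add_right[OF Xc])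
    then show ?thesis
      by (simp only:) (intro convergent_mult convergent_diff convergent_const conv, auto)
  qed
  define L where "L = mat n n (\<lambda>(i,j). lim (\<lambda>k. X k $$ (i,j)))"
  have Lc: "L \<in> carrier_mat n n" by (simp add: L_def)
  have lim: "(\<lambda>k. bil (X k) x y) \<longlonglongrightarrow> bil L x y" if xy: "x \<in> carrier_vec n" "y \<in> carrier_vec n" for x y
    unfolding bil_sum[OF Xc xy] bil_sum[OF Lc xy]
    using conv_entry by (auto intro!: tendsto_intros simp: L_def convergent_LIMSEQ_iff)
  show thesis
  proof
    show "symmetric_matrix n L"
    proof (rule symmetric_matrixI[OF Lc])
      fix x y :: "real vec" assume xy: "x \<in> carrier_vec n" "y \<in> carrier_vec n"
      show "bil L x y = bil L y x"
        using LIMSEQ_unique[OF lim[OF xy]] lim[OF xy(2,1)] sym[OF xy] by simp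
    qed
    fix x y :: "real vec" assume xy: "x \<in> carrier_vec n" "y \<in> carrier_vec n"
    have "(\<lambda>k. bil (X (Suc k)) x y) \<longlonglongrightarrow> bil S x y + bil L (F *\<^sub>v x) (F *\<^sub>v y)"
      unfolding bilX[OF xy] by (intro tendsto_intros lim Fx xy)
    with LIMSEQ_Suc[OF lim[OF xy]] show "bil L x y = bil S x y + bil L (F *\<^sub>v x) (F *\<^sub>v y)"
      by (rule LIMSEQ_unique)
  qed
qed

text \<open>Rearranged as P = S + F^T P F, the equation can be iterated along trajectories.\<close>

lemma lyapunov_equation_iff_stein:
  assumes F: "closed_loop g A B K \<in> carrier_mat n n" and P: "P \<in> carrier_mat n n"
    and Q: "Q \<in> carrier_mat n n" and R: "R \<in> carrier_mat m m" and K: "K \<in> carrier_mat m n"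
  shows "lyapunov_equation g A B Q R K P \<longleftrightarrow> (\<forall>x \<in> carrier_vec n. \<forall>y \<in> carrier_vec n.
    bil P x y = bil (Q + K\<^sup>T * R * K) x y + bil P (closed_loop g A B K *\<^sub>v x) (closed_loop g A B K *\<^sub>v y))"
    (is "_ \<longleftrightarrow> ?rhs")
proof -
  let ?F = "closed_loop g A B K"
  have KRK: "K\<^sup>T * R * K \<in> carrier_mat n n" and FPF: "?F\<^sup>T * P * ?F \<in> carrier_mat n n"
    using assms by auto
  have Lc: "?F\<^sup>T * P * ?F - P \<in> carrier_mat n n" and Rc: "- Q - K\<^sup>T * R * K \<in> carrier_mat n n"
    and Q': "- Q \<in> carrier_mat n n"
    using P Q KRK FPF by (auto simp: minus_carrier_mat)
  have "bil (?F\<^sup>T * P * ?F - P) x y = bil (- Q - K\<^sup>T * R * K) x y \<longleftrightarrow>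
      bil P x y = bil (Q + K\<^sup>T * R * K) x y + bil P (?F *\<^sub>v x) (?F *\<^sub>v y)"
    if xy: "x \<in> carrier_vec n" "y \<in> carrier_vec n" for x y
    by (auto simp: bil_diff_mat[OF FPF P xy] bil_congruence[OF P F F xy] bil_diff_mat[OF Q' KRK xy]
        bil_uminus_mat[OF Q xy] bil_add_mat[OF Q KRK xy])
  then show ?thesis
    unfolding lyapunov_equation_def using mat_eqI_bil[OF Lc Rc] by metis
qed

subsection \<open>The gain update\<close>

lemma closed_loop_carrier:
  assumes "A \<in> carrier_mat n n" "B \<in> carrier_mat n m" "K \<in> carrier_mat m n"
  shows "closed_loop g A B K \<in> carrier_mat n n"
  using assms by (simp add: closed_loop_def minus_carrier_mat)

lemma closed_loop_mult_vec:
  assumes "A \<in> carrier_mat n n" "B \<in> carrier_mat n m" "K \<in> carrier_mat m n" "x \<in> carrier_vec n"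
  shows "closed_loop g A B K *\<^sub>v x = g \<cdot>\<^sub>v (A *\<^sub>v x - B *\<^sub>v (K *\<^sub>v x))"
proof -
  have "(A - B * K) *\<^sub>v x = A *\<^sub>v x - B *\<^sub>v (K *\<^sub>v x)"
    using assms minus_mult_distrib_mat_vec[of A n n "B * K" x] by simp
  moreover have "closed_loop g A B K *\<^sub>v x = g \<cdot>\<^sub>v ((A - B * K) *\<^sub>v x)"
    using assms unfolding closed_loop_def by (intro eq_vecI) auto
  ultimately show ?thesis by simp
qed

lemma pos_definite_state_cost:
  assumes Q: "pos_definite n Q" and R: "pos_definite m R" and K: "K \<in> carrier_mat m n"
  shows "pos_definite n (Q + K\<^sup>T * R * K)"
    and "\<And>x y. x \<in> carrier_vec n \<Longrightarrow> y \<in> carrier_vec n \<Longrightarrow>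
      bil (Q + K\<^sup>T * R * K) x y = bil Q x y + bil R (K *\<^sub>v x) (K *\<^sub>v y)"
proof -
  note Qc = pos_definiteD(2)[OF Q] and Rc = pos_definiteD(2)[OF R]
  have KRK: "K\<^sup>T * R * K \<in> carrier_mat n n" using K Rc by auto
  show *: "bil (Q + K\<^sup>T * R * K) x y = bil Q x y + bil R (K *\<^sub>v x) (K *\<^sub>v y)"
    if "x \<in> carrier_vec n" "y \<in> carrier_vec n" for x y
    by (simp add: bil_add_mat[OF Qc KRK that] bil_congruence[OF Rc K K that])
  have Kx: "K *\<^sub>v x \<in> carrier_vec m" if "x \<in> carrier_vec n" for x using that K by simp
  have "symmetric_matrix n (Q + K\<^sup>T * R * K)"
    by (rule symmetric_matrixI)
      (use Qc KRK * Kx bil_sym[OF pos_definiteD(1)[OF Q]] bil_sym[OF pos_definiteD(1)[OF R]] in auto)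
  then show "pos_definite n (Q + K\<^sup>T * R * K)"
    unfolding pos_definite_def bil_def[symmetric]
    using * pos_definiteD(3)[OF Q] pos_definiteD(4)[OF R Kx] by (auto intro: add_pos_nonneg)
qed

text \<open>Definiteness of N makes it invertible. From here on the gain is used only through its
  normal equation, not through the inverse.\<close>

lemma gain_update_solves:
  fixes g :: real
  assumes A: "A \<in> carrier_mat n n" and B: "B \<in> carrier_mat n m"
    and R: "pos_definite m R" and P: "pos_definite n P"
  defines "N \<equiv> R + g\<^sup>2 \<cdot>\<^sub>m (B\<^sup>T * P * B)"
  shows "gain_update g A B R P \<in> carrier_mat m n"
    and "pos_definite m N"
    and "N * gain_update g A B R P = g\<^sup>2 \<cdot>\<^sub>m (B\<^sup>T * P * A)"
    and "\<And>u w. u \<in> carrier_vec m \<Longrightarrow> w \<in> carrier_vec m \<Longrightarrow>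
      bil N u w = bil R u w + g\<^sup>2 * bil P (B *\<^sub>v u) (B *\<^sub>v w)"
proof -
  note Pc = pos_definiteD(2)[OF P] and Rc = pos_definiteD(2)[OF R]
  have BPB: "B\<^sup>T * P * B \<in> carrier_mat m m" using B Pc by auto
  have Bu: "B *\<^sub>v u \<in> carrier_vec n" if "u \<in> carrier_vec m" for u using B that by simp
  have Nc: "N \<in> carrier_mat m m" using BPB Rc by (simp add: N_def)
  show *: "bil N u w = bil R u w + g\<^sup>2 * bil P (B *\<^sub>v u) (B *\<^sub>v w)"
    if "u \<in> carrier_vec m" "w \<in> carrier_vec m" for u w
    using BPB by (simp add: N_def bil_add_mat[OF Rc _ that] bil_smult_mat[OF BPB that] bil_congruence[OF Pc B B that])
  have Nsym: "symmetric_matrix m N"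
    by (rule symmetric_matrixI)
      (use Nc * Bu bil_sym[OF pos_definiteD(1)[OF P]] bil_sym[OF pos_definiteD(1)[OF R]] in auto)
  then show Npos: "pos_definite m N"
    unfolding pos_definite_def bil_def[symmetric]
    using * pos_definiteD(3)[OF R] pos_definiteD(4)[OF P Bu] by (auto intro!: add_pos_nonneg)
  have "v = 0\<^sub>v m" if v: "v \<in> carrier_vec m" "N *\<^sub>v v = 0\<^sub>v m" for v
    using pos_definiteD(3)[OF Npos v(1)] v by (auto simp: bil_def)
  then obtain L where L: "mat_inverse N = Some L" "L \<in> carrier_mat m m" "N * L = 1\<^sub>m m"
    using mat_inverse_of_inj[OF Nc] by metis
  have BPA: "B\<^sup>T * P * A \<in> carrier_mat m n" using A B Pc by auto
  have K: "gain_update g A B R P = g\<^sup>2 \<cdot>\<^sub>m (L * (B\<^sup>T * P * A))"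
    using L(1,2) A B Pc unfolding gain_update_def N_def[symmetric]
    by (simp add: assoc_mult_mat[of _ m m _ n _ n] assoc_mult_mat[of _ m n _ n _ n])
  show "gain_update g A B R P \<in> carrier_mat m n" using L(2) BPA by (simp add: K)
  have "N * gain_update g A B R P = g\<^sup>2 \<cdot>\<^sub>m (N * (L * (B\<^sup>T * P * A)))"
    unfolding K by (rule mult_smult_distrib[OF Nc mult_carrier_mat[OF L(2) BPA]])
  also have "N * (L * (B\<^sup>T * P * A)) = B\<^sup>T * P * A"
    using assoc_mult_mat[OF Nc L(2) BPA] L(3) left_mult_one_mat[OF BPA] by metis
  finally show "N * gain_update g A B R P = g\<^sup>2 \<cdot>\<^sub>m (B\<^sup>T * P * A)" .
qed

text \<open>The updated gain minimises $u \mapsto \gamma^2 V(Ax - Bu) + u^T R u$, where $V$ is the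
  quadratic form of $P$: completing the square leaves the form of $N = R + \gamma^2 B^T P B$
  evaluated at the difference to the minimiser.\<close>

lemma gain_update_decrease:
  fixes g :: real
  assumes A: "A \<in> carrier_mat n n" and B: "B \<in> carrier_mat n m" and K: "K \<in> carrier_mat m n"
    and Q: "pos_definite n Q" and R: "pos_definite m R" and P: "pos_definite n P"
    and lyap: "lyapunov_equation g A B Q R K P"
    and x: "x \<in> carrier_vec n"
  defines "L \<equiv> gain_update g A B R P"
  shows "bil P (closed_loop g A B L *\<^sub>v x) (closed_loop g A B L *\<^sub>v x)
    \<le> bil P x x - bil (Q + L\<^sup>T * R * L) x x"
proof -
  define N where "N = R + g\<^sup>2 \<cdot>\<^sub>m (B\<^sup>T * P * B)"
  note gain = gain_update_solves[OF A B R P, where g = g, folded N_def L_def]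
  note Pc = pos_definiteD(2)[OF P] and Rc = pos_definiteD(2)[OF R] and Qc = pos_definiteD(2)[OF Q]
    and Nc = pos_definiteD(2)[OF gain(2)]
  define a u w where "a = A *\<^sub>v x" and "u = K *\<^sub>v x" and "w = L *\<^sub>v x"
  have au: "a \<in> carrier_vec n" "u \<in> carrier_vec m" "w \<in> carrier_vec m"
    using A K gain(1) x by (auto simp: a_def u_def w_def)
  have Bc: "B *\<^sub>v v \<in> carrier_vec n" if "v \<in> carrier_vec m" for v using B that by simp
  have BPA: "B\<^sup>T * P * A \<in> carrier_mat m n" using A B Pc by auto
  \<comment> \<open>The normal equation tested against v: it matches the cross term in the expanded
    cost.\<close>
  have Nw: "bil N v w = g\<^sup>2 * bil P (B *\<^sub>v v) a" if v: "v \<in> carrier_vec m" for v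
  proof -
    have "bil N v w = bil (N * L) v x" unfolding w_def by (rule bil_mult_right[OF Nc gain(1) v x, symmetric])
    then show ?thesis
      by (simp add: gain(3) bil_smult_mat[OF BPA v x] bil_congruence[OF Pc B A v x] a_def)
  qed
  have cost: "g\<^sup>2 * bil P (a - B *\<^sub>v v) (a - B *\<^sub>v v) + bil R v v
      = g\<^sup>2 * bil P a a - bil N w w + bil N (v - w) (v - w)" if v: "v \<in> carrier_vec m" for v
    using bil_sym[OF pos_definiteD(1)[OF P] au(1) Bc[OF v]] bil_sym[OF pos_definiteD(1)[OF gain(2)] au(3) v]
      Nw[OF v] gain(4)[OF v v] v au Bc[OF v]
    by (simp add: bil_diff_left[OF Pc] bil_diff_right[OF Pc] bil_diff_left[OF Nc] bil_diff_right[OF Nc]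
        algebra_simps)
  have cl: "bil P (closed_loop g A B M *\<^sub>v x) (closed_loop g A B M *\<^sub>v x)
      = g\<^sup>2 * bil P (a - B *\<^sub>v (M *\<^sub>v x)) (a - B *\<^sub>v (M *\<^sub>v x))" if M: "M \<in> carrier_mat m n" for M
  proof -
    have "a - B *\<^sub>v (M *\<^sub>v x) \<in> carrier_vec n" using au Bc M x by simp
    then show ?thesis
      by (simp add: closed_loop_mult_vec[OF A B M x] bil_smult_left[OF Pc] bil_smult_right[OF Pc]
          power2_eq_square a_def[symmetric])
  qed
  \<comment> \<open>The completed square vanishes at the new input w and is nonnegative at the old
    input u, so w costs no more than u.\<close>
  have "bil N (w - w) (w - w) = 0" using bil_diff_left[OF Nc au(3,3), of "w - w"] au by simp
  then have "bil P (closed_loop g A B L *\<^sub>v x) (closed_loop g A B L *\<^sub>v x) + bil R w w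
      \<le> bil P (closed_loop g A B K *\<^sub>v x) (closed_loop g A B K *\<^sub>v x) + bil R u u"
    using cost[OF au(2)] cost[OF au(3)] pos_definiteD(4)[OF gain(2), of "u - w"] au
    by (simp add: cl[OF K] cl[OF gain(1)] u_def[symmetric] w_def[symmetric])
  moreover have "bil P x x = bil (Q + K\<^sup>T * R * K) x x
      + bil P (closed_loop g A B K *\<^sub>v x) (closed_loop g A B K *\<^sub>v x)"
    using lyap x lyapunov_equation_iff_stein[OF closed_loop_carrier[OF A B K] Pc Qc Rc K] by blast
  ultimately show ?thesis
    using pos_definite_state_cost(2)[OF Q R K x x] pos_definite_state_cost(2)[OF Q R gain(1) x x]
    by (simp add: u_def w_def)
qed

text \<open>If $\sigma_{\max}$ in the step bound vanishes, then the quotient is the junk value 0 and the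
  bound excludes every positive increment.\<close>

lemma step_bound_decrease:
  fixes g :: real
  assumes A: "A \<in> carrier_mat n n" and B: "B \<in> carrier_mat n m" and K: "K \<in> carrier_mat m n"
    and n: "n > 0" and Q: "pos_definite n Q" and R: "pos_definite m R" and P: "pos_definite n P"
    and g: "g > 0" and lyap: "lyapunov_equation g A B Q R K P"
  defines "L \<equiv> gain_update g A B R P"
  assumes h: "0 < h" "h < step_bound g Q R P L"
  obtains d where "d > 0" "\<And>x. x \<in> carrier_vec n \<Longrightarrow>
    bil P (closed_loop (g + h) A B L *\<^sub>v x) (closed_loop (g + h) A B L *\<^sub>v x) + d * (x \<bullet> x) \<le> bil P x x"
proof -
  note L = gain_update_solves(1)[OF A B R P, where g = g, folded L_def]
  note Pc = pos_definiteD(2)[OF P] and Rc = pos_definiteD(2)[OF R] and Qc = pos_definiteD(2)[OF Q]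
  define S where "S = Q + L\<^sup>T * R * L"
  note Spos = pos_definite_state_cost(1)[OF Q R L, folded S_def]
  note Sc = pos_definiteD(2)[OF Spos]
  have PS: "P - Q - L\<^sup>T * R * L = P - S"
    unfolding S_def using Pc Qc Rc L by (intro eq_matI) auto
  have PSsym: "symmetric_matrix n (P - S)"
    by (rule symmetric_matrixI)
      (use Pc Sc bil_diff_mat[OF Pc Sc] bil_sym[OF pos_definiteD(1)[OF P]]
        bil_sym[OF pos_definiteD(1)[OF Spos]] in \<open>auto simp: minus_carrier_mat\<close>)
  define M s where "M = sigma_max (P - S)" and "s = sigma_min S"
  have M: "\<forall>x \<in> carrier_vec n. bil (P - S) x x \<le> M * (x \<bullet> x)" "M \<ge> 0"
    using bil_le_sigma_max[OF PSsym n] by (simp_all add: M_def)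
  define r where "r = (g + h) / g"
  have r1: "r > 1" using g h by (simp add: r_def)
  have "g * r < g * sqrt (s / M + 1)"
    using h(2) g by (simp add: step_bound_def PS S_def[symmetric] M_def s_def r_def)
  then have rs: "r < sqrt (s / M + 1)" using g by simp
  have "M \<noteq> 0" using rs r1 by auto
  then have Mpos: "M > 0" using M(2) by simp
  have "r\<^sup>2 < s / M + 1"
    using rs r1 by (smt (verit) real_le_lsqrt)
  \<comment> \<open>This margin is the d of the conclusion: what \<open>sigma_min\<close> leaves
    after the rescaling has been paid for.\<close>
  then have d: "s - (r\<^sup>2 - 1) * M > 0" using Mpos by (simp add: field_simps)
  show thesis
  proof (rule that[OF d])
    fix x :: "real vec" assume x: "x \<in> carrier_vec n"
    define y where "y = A *\<^sub>v x - B *\<^sub>v (L *\<^sub>v x)"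
    have y: "y \<in> carrier_vec n" using A B L x by (simp add: y_def mult_mat_vec_carrier[of _ n n] mult_mat_vec_carrier[of _ n m])
    have cl: "bil P (closed_loop c A B L *\<^sub>v x) (closed_loop c A B L *\<^sub>v x) = c\<^sup>2 * bil P y y" for c
      using y by (simp add: closed_loop_mult_vec[OF A B L x] y_def[symmetric] bil_smult_left[OF Pc]
          bil_smult_right[OF Pc] power2_eq_square)
    have PSx: "bil (P - S) x x = bil P x x - bil S x x" by (rule bil_diff_mat[OF Pc Sc x x])
    have "g\<^sup>2 * bil P y y \<le> bil (P - S) x x"
      using gain_update_decrease[OF A B K Q R P lyap x, folded L_def] cl[of g] PSx
      by (simp add: S_def)
    then have "r\<^sup>2 * (g\<^sup>2 * bil P y y) \<le> r\<^sup>2 * bil (P - S) x x" by (intro mult_left_mono) auto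
    moreover have "r\<^sup>2 * (g\<^sup>2 * bil P y y) = (g + h)\<^sup>2 * bil P y y"
      using g by (simp add: r_def power_divide)
    moreover have "(r\<^sup>2 - 1) * bil (P - S) x x \<le> (r\<^sup>2 - 1) * (M * (x \<bullet> x))"
      using M(1) x r1 by (intro mult_left_mono) auto
    moreover have "s * (x \<bullet> x) \<le> bil S x x"
      unfolding s_def by (rule bil_ge_sigma_min[OF Spos n x])
    \<comment> \<open>Splitting r^2 = 1 + (r^2 - 1): the unit part returns the form of P - S
      exactly, and only the surplus is estimated by M.\<close>
    moreover have "r\<^sup>2 * bil (P - S) x x = bil (P - S) x x + (r\<^sup>2 - 1) * bil (P - S) x x"
      "(s - (r\<^sup>2 - 1) * M) * (x \<bullet> x) = s * (x \<bullet> x) - (r\<^sup>2 - 1) * (M * (x \<bullet> x))"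
      by (simp_all add: algebra_simps)
    ultimately show "bil P (closed_loop (g + h) A B L *\<^sub>v x) (closed_loop (g + h) A B L *\<^sub>v x)
        + (s - (r\<^sup>2 - 1) * M) * (x \<bullet> x) \<le> bil P x x"
      using PSx unfolding cl by linarith
  qed
qed

section \<open>Induction along the iteration\<close>

theorem theorem2:
  fixes n\<^sub>x n\<^sub>u :: nat
    and A B Q R :: "real mat"
    and \<beta> :: real
    and \<alpha> \<gamma> :: "nat \<Rightarrow> real"
    and P K :: "nat \<Rightarrow> real mat"
    and j :: nat
  assumes "n\<^sub>x > 0" and "n\<^sub>u > 0"
    and "A \<in> carrier_mat n\<^sub>x n\<^sub>x" and "B \<in> carrier_mat n\<^sub>x n\<^sub>u"
    and "stabilizable n\<^sub>x n\<^sub>u A B"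
    and "real_spectral_radius A > 0"
    and "pos_definite n\<^sub>x Q" and "pos_definite n\<^sub>u R"
    and "\<beta> > 0" and "\<alpha> 0 > 0" and "\<beta> + \<alpha> 0 < 1 / real_spectral_radius A"
    and "\<And>i. \<gamma> i = \<beta> + (\<Sum>m\<le>i. \<alpha> m)"
    and "K 0 = 0\<^sub>m n\<^sub>u n\<^sub>x"
    and "\<And>i. i \<le> j \<Longrightarrow> symmetric_matrix n\<^sub>x (P i)"
    and "\<And>i. i \<le> j \<Longrightarrow> lyapunov_equation (\<gamma> i) A B Q R (K i) (P i)"
    and "\<And>i. i \<le> j \<Longrightarrow> K (Suc i) = gain_update (\<gamma> i) A B R (P i)"
    and "\<And>i. i \<le> j \<Longrightarrow> 0 < \<alpha> (Suc i) \<and> \<alpha> (Suc i) < step_bound (\<gamma> i) Q R (P i) (K (Suc i))"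
  shows "(\<exists>!P'. pos_definite n\<^sub>x P' \<and>
            lyapunov_equation (\<gamma> (Suc j)) A B Q R (K (Suc j)) P') \<and>
         real_spectral_radius (closed_loop (\<gamma> (Suc j)) A B (K (Suc j))) < 1"
proof -
  note n = assms(1) and A = assms(3) and B = assms(4) and Q = assms(7) and R = assms(8)
    and \<gamma> = assms(12) and Psym = assms(14) and lyap = assms(15) and gain = assms(16) and step = assms(17)
  note Qc = pos_definiteD(2)[OF Q] and Rc = pos_definiteD(2)[OF R]
  let ?cl = "\<lambda>i. closed_loop (\<gamma> i) A B (K i)"
  have \<gamma>_Suc: "\<gamma> (Suc i) = \<gamma> i + \<alpha> (Suc i)" for i by (simp add: \<gamma>)
  have \<gamma>_pos: "i \<le> j \<Longrightarrow> \<gamma> i > 0" for i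
  proof (induction i)
    case 0
    show ?case using assms(9,10) by (simp add: \<gamma>)
  next
    case (Suc i)
    then show ?case using step[of i] by (simp add: \<gamma>_Suc)
  qed
  have P_pos: "pos_definite n\<^sub>x (P i)"
    if "i \<le> j" and K: "K i \<in> carrier_mat n\<^sub>u n\<^sub>x" and stable: "real_spectral_radius (?cl i) < 1" for i
  proof (rule stable_stein_pos_definite[OF closed_loop_carrier[OF A B K] n stable Psym[OF that(1)]
        pos_definite_state_cost(1)[OF Q R K]])
    fix x :: "real vec" assume "x \<in> carrier_vec n\<^sub>x"
    then show "bil (P i) x x = bil (Q + (K i)\<^sup>T * R * K i) x x + bil (P i) (?cl i *\<^sub>v x) (?cl i *\<^sub>v x)"
      using lyap[OF that(1)] lyapunov_equation_iff_stein[OF closed_loop_carrier[OF A B K]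
          symmetric_matrixD(1)[OF Psym[OF that(1)]] Qc Rc K] by blast
  qed
  have K_Suc: "K (Suc i) \<in> carrier_mat n\<^sub>u n\<^sub>x" if "i \<le> j" "pos_definite n\<^sub>x (P i)" for i
    using gain_update_solves(1)[OF A B R that(2)] gain[OF that(1)] by simp
  have decrease: "\<exists>d > 0. \<forall>x \<in> carrier_vec n\<^sub>x.
      bil (P i) (?cl (Suc i) *\<^sub>v x) (?cl (Suc i) *\<^sub>v x) + d * (x \<bullet> x) \<le> bil (P i) x x"
    if i: "i \<le> j" and K: "K i \<in> carrier_mat n\<^sub>u n\<^sub>x" and P: "pos_definite n\<^sub>x (P i)" for i
    using step_bound_decrease[OF A B K n Q R P \<gamma>_pos[OF i] lyap[OF i], of "\<alpha> (Suc i)"] step[OF i]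
    unfolding \<gamma>_Suc gain[OF i] by metis
  have stable_Suc: "real_spectral_radius (?cl (Suc i)) < 1"
    if i: "i \<le> j" and K: "K i \<in> carrier_mat n\<^sub>u n\<^sub>x" and P: "pos_definite n\<^sub>x (P i)" for i
  proof -
    obtain d where d: "d > 0" "\<And>x. x \<in> carrier_vec n\<^sub>x \<Longrightarrow>
        bil (P i) (?cl (Suc i) *\<^sub>v x) (?cl (Suc i) *\<^sub>v x) + d * (x \<bullet> x) \<le> bil (P i) x x"
      using decrease[OF i K P] by auto
    show ?thesis
    proof (rule lyapunov_decrease_stable[OF closed_loop_carrier[OF A B K_Suc[OF i P]] n P])
      fix x :: "real vec" assume x: "x \<in> carrier_vec n\<^sub>x" "x \<noteq> 0\<^sub>v n\<^sub>x"
      show "bil (P i) (?cl (Suc i) *\<^sub>v x) (?cl (Suc i) *\<^sub>v x) < bil (P i) x x"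
        using d(2)[OF x(1)] mult_pos_pos[OF d(1) scalar_prod_self_pos[OF x]] by linarith
    qed
  qed
  \<comment> \<open>The range ends at \<open>Suc j\<close>: passing from i to \<open>Suc i\<close>
    uses only \<open>P i\<close> with i at most j, and the last instance is the stability to be
    proved.\<close>
  have inv: "K i \<in> carrier_mat n\<^sub>u n\<^sub>x \<and> real_spectral_radius (?cl i) < 1" if "i \<le> Suc j" for i
    using that
  proof (induction i)
    case 0
    have "?cl 0 = (\<beta> + \<alpha> 0) \<cdot>\<^sub>m A"
      using A B unfolding closed_loop_def assms(13) by (intro eq_matI) (auto simp: \<gamma>)
    moreover have "real_spectral_radius A < 1 / (\<beta> + \<alpha> 0)"
      using assms(6,9,10,11) by (simp add: field_simps)
    then have "real_spectral_radius ((\<beta> + \<alpha> 0) \<cdot>\<^sub>m A) < (\<beta> + \<alpha> 0) * (1 / (\<beta> + \<alpha> 0))"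
      using assms(9,10) by (intro real_spectral_radius_smult_less[OF A n]) auto
    ultimately show ?case using assms(9,10,13) by simp
  next
    case (Suc i)
    then show ?case using P_pos K_Suc stable_Suc by simp
  qed
  have Kj: "K j \<in> carrier_mat n\<^sub>u n\<^sub>x" and Pj: "pos_definite n\<^sub>x (P j)"
    using inv[of j] P_pos[of j] by auto
  have K: "K (Suc j) \<in> carrier_mat n\<^sub>u n\<^sub>x" and stable: "real_spectral_radius (?cl (Suc j)) < 1"
    using inv[of "Suc j"] by auto
  let ?S = "Q + (K (Suc j))\<^sup>T * R * K (Suc j)"
  note F = closed_loop_carrier[OF A B K, of "\<gamma> (Suc j)"]
    and S = pos_definite_state_cost(1)[OF Q R K]
  note stein = lyapunov_equation_iff_stein[OF F _ Qc Rc K]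
  \<comment> \<open>The decrease behind stability is reused: \<open>P j\<close> dominates the series
    for the next solution.\<close>
  obtain d where d: "d > 0" "\<And>x. x \<in> carrier_vec n\<^sub>x \<Longrightarrow>
      bil (P j) (?cl (Suc j) *\<^sub>v x) (?cl (Suc j) *\<^sub>v x) + d * (x \<bullet> x) \<le> bil (P j) x x"
    using decrease[OF order_refl Kj Pj] by auto
  obtain X where X: "symmetric_matrix n\<^sub>x X"
    "\<And>x y. x \<in> carrier_vec n\<^sub>x \<Longrightarrow> y \<in> carrier_vec n\<^sub>x \<Longrightarrow>
      bil X x y = bil ?S x y + bil X (?cl (Suc j) *\<^sub>v x) (?cl (Suc j) *\<^sub>v y)"
    using stein_solution_exists[OF F n S Pj d] by blast
  have "pos_definite n\<^sub>x X"
    by (rule stable_stein_pos_definite[OF F n stable X(1) S]) (rule X(2))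
  moreover have "lyapunov_equation (\<gamma> (Suc j)) A B Q R (K (Suc j)) X"
    using stein[OF symmetric_matrixD(1)[OF X(1)]] X(2) by blast
  moreover have "Y = X"
    if "pos_definite n\<^sub>x Y" "lyapunov_equation (\<gamma> (Suc j)) A B Q R (K (Suc j)) Y" for Y
    by (rule stein_solution_unique[OF F n stable _ _ _ X(2)])
      (use that stein[OF pos_definiteD(2)[OF that(1)]] pos_definiteD(2) symmetric_matrixD(1)[OF X(1)] in auto)
  ultimately show ?thesis using stable by blast
qed

end
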